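(* Let $V$ be a real vector space with linear dual $V^{\#}$, and let $f\colon V\to\overline{\mathbb{R}}$ and $g\colon V^{\#}\to\overline{\mathbb{R}}$ be arbitrary functions. Then $$\sup_{k\in V^{\#}}\{f^{\star}(k)-g(k)\}=\sup_{x\in V}\{g^{\star}(x)-f(x)\},$$ where $f^{\star}\colon V^{\#}\to\overline{\mathbb{R}}$ and $g^{\star}\colon V\to\overline{\mathbb{R}}$ are the Legendre-Fenchel transform of $f$ and the reverse Legendre-Fenchel transform of $g$.
   Context: $\overline{\mathbb{R}}=[-\infty,+\infty]$. Addition on $\overline{\mathbb{R}}$ extends that of $\mathbb{R}$ by $(+\infty)+y=y+(+\infty)=+\infty$ for all $y\in\overline{\mathbb{R}}$ (including $y=-\infty$) and $(-\infty)+y=y+(-\infty)=-\infty$ for all $y<+\infty$. Subtraction on $\overline{\mathbb{R}}$ is defined by $c-b:=\inf\{a\in\overline{\mathbb{R}}\mid a+b\ge c\}$. Thus it is the usual subtraction on finite values; $c-(+\infty)=-\infty$ for every $c$; $(-\infty)-b=-\infty$ for every $b$; $c-(-\infty)=+\infty$ for every $c>-\infty$; $(+\infty)-b=+\infty$ for every $b<+\infty$. In particular $(+\infty)-(+\infty)=-\infty=(-\infty)-(-\infty)$. For $x\in V$ and $k\in V^{\#}$ write $\langle x,k\rangle:=k(x)\in\mathbb{R}$. For $f\colon V\to\overline{\mathbb{R}}$ and $g\colon V^{\#}\to\overline{\mathbb{R}}$ the transforms are $$f^{\star}(k):=\sup_{x\in V}\{\langle x,k\rangle-f(x)\},\qquad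 g^{\star}(x):=\sup_{k\in V^{\#}}\{\langle x,k\rangle-g(k)\}.$$ *)

theory Defs
  imports "HOL-Library.Extended_Real"
begin

definition algebraic_dual :: "('v::real_vector \<Rightarrow> real) set" where
  "algebraic_dual = {k. linear k}"

text \<open>
  Addition on \<^typ>\<open>ereal\<close> satisfies \<open>\<infinity> + y = y + \<infinity> = \<infinity>\<close> for every \<open>y\<close>, including \<open>y = -\<infinity>\<close>,
  which is the convention wanted here.  Subtraction on \<^typ>\<open>ereal\<close>, however, is \<open>c + (- b)\<close>, so there
  \<open>\<infinity> - \<infinity> = \<infinity>\<close> and \<open>(-\<infinity>) - (-\<infinity>) = \<infinity>\<close>.  The subtraction used below is instead the residual of
  addition; it takes the value \<open>-\<infinity>\<close> in both of these cases.
\<close>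

definition residual_minus :: "ereal \<Rightarrow> ereal \<Rightarrow> ereal" (infixl "\<ominus>" 65) where
  "c \<ominus> b = Inf {a. c \<le> a + b}"

lemma residual_minus_ereal: "ereal x \<ominus> ereal y = ereal (x - y)"
proof -
  have "{a. ereal x \<le> a + ereal y} = {ereal (x - y)..}"
  proof (intro set_eqI)
    fix a show "a \<in> {a. ereal x \<le> a + ereal y} \<longleftrightarrow> a \<in> {ereal (x - y)..}"
      by (cases a) auto
  qed
  then show ?thesis by (simp add: residual_minus_def)
qed

lemma residual_minus_PInf_right: "c \<ominus> \<infinity> = -\<infinity>"
  by (simp add: residual_minus_def bot_ereal_def)

lemma residual_minus_MInf_left: "(-\<infinity>) \<ominus> b = -\<infinity>"
  by (simp add: residual_minus_def bot_ereal_def)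

lemma residual_minus_MInf_right:
  assumes "-\<infinity> < c" shows "c \<ominus> (-\<infinity>) = \<infinity>"
proof -
  have "{a. c \<le> a + (-\<infinity>)} = {\<infinity>}"
  proof (intro set_eqI)
    fix a show "a \<in> {a. c \<le> a + (-\<infinity>)} \<longleftrightarrow> a \<in> {\<infinity>}"
      using assms by (cases a) auto
  qed
  then show ?thesis by (simp add: residual_minus_def)
qed

lemma residual_minus_PInf_left:
  assumes "b < \<infinity>" shows "\<infinity> \<ominus> b = \<infinity>"
proof -
  have "{a. \<infinity> \<le> a + b} = {\<infinity>}"
    using assms by (cases b) auto
  then show ?thesis by (simp add: residual_minus_def)
qed

definition fenchel :: "('v::real_vector \<Rightarrow> ereal) \<Rightarrow> ('v \<Rightarrow> real) \<Rightarrow> ereal" where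
  "fenchel f k = (SUP x. ereal (k x) \<ominus> f x)"

text \<open>
  A function on the dual is represented by a function on all of \<^typ>\<open>'v::real_vector \<Rightarrow> real\<close>; its values
  outside \<^const>\<open>algebraic_dual\<close> are never used.
\<close>

definition reverse_fenchel :: "(('v::real_vector \<Rightarrow> real) \<Rightarrow> ereal) \<Rightarrow> 'v \<Rightarrow> ereal" where
  "reverse_fenchel g x = (SUP k\<in>algebraic_dual. ereal (k x) \<ominus> g k)"

end

theory Submission
  imports Defs
begin

text \<open>
  Residual subtraction is left adjoint to addition: \<open>c \<ominus> b \<le> a\<close> iff \<open>c \<le> a + b\<close>.  Hence, by
  associativity and commutativity of addition, \<open>a\<close> is an upper bound of either side iff
  \<open>\<langle>x,k\<rangle> \<le> a + f x + g k\<close> for all \<open>x\<close> and \<open>k\<close>, so both suprema have the same upper bounds.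
\<close>

text \<open>The defining infimum is attained; for infinite \<open>b\<close> this rests on
  \<open>\<infinity> + (-\<infinity>) = \<infinity>\<close>.\<close>

lemma residual_minus_le_iff: "c \<ominus> b \<le> a \<longleftrightarrow> c \<le> a + b"
proof (cases b)
  case (real r)
  show ?thesis
    by (cases c; cases a)
      (auto simp: real residual_minus_ereal residual_minus_MInf_left residual_minus_PInf_left)
next
  case PInf
  then show ?thesis by (simp add: residual_minus_PInf_right)
next
  case MInf
  show ?thesis
    by (cases c; cases a)
      (auto simp: MInf residual_minus_MInf_right residual_minus_MInf_left)
qed

text \<open>The adjunction moves \<open>b\<close>, then each \<open>f x\<close>, to the right. The
  summands are ordered so that \<open>b = g k\<close> here and \<open>b = f x\<close> in the reverse
  version give the same term.\<close>

lemma fenchel_residual_le_iff: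
  "fenchel f k \<ominus> b \<le> a \<longleftrightarrow> (\<forall>x. ereal (k x) \<le> a + f x + b)"
  by (simp add: fenchel_def residual_minus_le_iff SUP_le_iff ac_simps)

lemma reverse_fenchel_residual_le_iff:
  "reverse_fenchel g x \<ominus> b \<le> a \<longleftrightarrow> (\<forall>k\<in>algebraic_dual. ereal (k x) \<le> a + b + g k)"
  by (simp add: reverse_fenchel_def residual_minus_le_iff SUP_le_iff)

theorem theorem2:
  fixes f :: "'v::real_vector \<Rightarrow> ereal"
    and g :: "('v \<Rightarrow> real) \<Rightarrow> ereal"
  shows "(SUP k\<in>algebraic_dual. fenchel f k \<ominus> g k) = (SUP x. reverse_fenchel g x \<ominus> f x)"
proof -
  have "(SUP k\<in>algebraic_dual. fenchel f k \<ominus> g k) \<le> a \<longleftrightarrow> (SUP x. reverse_fenchel g x \<ominus> f x) \<le> a" for a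
    by (auto simp: SUP_le_iff fenchel_residual_le_iff reverse_fenchel_residual_le_iff)
  \<comment> \<open>Taking each supremum in turn as \<open>a\<close> yields both
    inequalities.\<close>
  then show ?thesis by (meson order_antisym order_refl)
qed

end
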